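(* Let $\Omega\subset\mathbb{R}^d$ be a bounded $C^2$ domain and let $\rho$ be a probability density on $\Omega$ with $1/\rho^*<\rho(x)<\rho^*$ for all $x\in\Omega$, for some constant $\rho^*$. Let $\kappa>0$ and let $(h_n)$ be a sequence of positive numbers with $h_n\to0$. For each $n$ let $T_n$ be a minimizer, among measurable maps $T:\Omega\to\mathbb{R}^m$, of the energy $$\tilde{\mathrm{A}}_{h_n}[T]+\tilde{\mathrm{R}}[T].$$ Then $T_n$ does not converge pointwise to any $T^*\in L^\infty(\Omega;\mathbb{R}^m)$.
   Context: Set $\sigma_\kappa(x)=\frac{1}{\sqrt{2\pi e}}\left(\frac{\kappa}{\rho(x)}\right)^{1/d}$. For $h>0$ and measurable $T:\Omega\to\mathbb{R}^m$ define $$\tilde{\mathrm{A}}_h[T]=\int_\Omega\frac{\int_\Omega\exp\left(\frac{-|x-x'|^2}{2h^2\sigma_\kappa^2(x)}\right)\log\left(1+|T(x)-T(x')|^2\right)\rho(x')\,dx'}{\int_\Omega\exp\left(\frac{-|x-x'|^2}{2h^2\sigma_\kappa^2(x)}\right)\rho(x')\,dx'}\,\rho(x)\,dx\in[0,\infty],$$ $$\tilde{\mathrm{R}}[T]=\log\left(\int_\Omega\int_\Omega\frac{1}{1+|T(x)-T(x')|^2}\,\rho(x)\rho(x')\,dx\,dx'\right).$$ *)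

theory Defs
  imports "HOL-Analysis.Analysis"
begin

definition C2_function :: "('a::real_normed_vector \<Rightarrow> real) \<Rightarrow> bool" where
  "C2_function f \<longleftrightarrow>
     (\<exists>(f' :: 'a \<Rightarrow> ('a \<Rightarrow>\<^sub>L real)) (f'' :: 'a \<Rightarrow> ('a \<Rightarrow>\<^sub>L ('a \<Rightarrow>\<^sub>L real))).
        (\<forall>x. (f has_derivative blinfun_apply (f' x)) (at x)) \<and>
        (\<forall>x. (f' has_derivative blinfun_apply (f'' x)) (at x)) \<and>
        continuous_on UNIV f'')"

text \<open>
  Near each boundary point a $C^2$ domain is the region above the graph of a $C^2$ function, in
  Cartesian coordinates whose last axis is directed along a unit vector \<open>\<nu>\<close>. The vector
  \<open>x - (x \<bullet> \<nu>) *\<^sub>R \<nu>\<close> consists of the remaining coordinates of \<open>x\<close>; the graph function \<open>\<gamma>\<close> is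
  defined on the whole space, but only its values on the hyperplane orthogonal to \<open>\<nu>\<close> are used.
\<close>
definition C2_domain :: "'a::euclidean_space set \<Rightarrow> bool" where
  "C2_domain \<Omega> \<longleftrightarrow> open \<Omega> \<and> connected \<Omega> \<and> \<Omega> \<noteq> {} \<and>
     (\<forall>p\<in>frontier \<Omega>. \<exists>r>0. \<exists>\<nu> \<gamma>. norm \<nu> = 1 \<and> C2_function \<gamma> \<and>
        \<Omega> \<inter> ball p r = {x \<in> ball p r. \<gamma> (x - (x \<bullet> \<nu>) *\<^sub>R \<nu>) < x \<bullet> \<nu>})"

definition prob_density_on :: "'a::euclidean_space set \<Rightarrow> ('a \<Rightarrow> real) \<Rightarrow> bool" where
  "prob_density_on \<Omega> \<rho> \<longleftrightarrow> \<rho> \<in> borel_measurable (lebesgue_on \<Omega>) \<and> (\<forall>x\<in>\<Omega>. 0 \<le> \<rho> x) \<and>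
     (\<integral>\<^sup>+x. ennreal (\<rho> x) \<partial>lebesgue_on \<Omega>) = 1"

definition sigma :: "real \<Rightarrow> (real^'d \<Rightarrow> real) \<Rightarrow> real^'d \<Rightarrow> real" where
  "sigma \<kappa> \<rho> x = 1 / sqrt (2 * pi * exp 1) * (\<kappa> / \<rho> x) powr (1 / real CARD('d))"

definition kernel :: "real \<Rightarrow> (real^'d \<Rightarrow> real) \<Rightarrow> real \<Rightarrow> real^'d \<Rightarrow> real^'d \<Rightarrow> real" where
  "kernel \<kappa> \<rho> h x x' = exp (- (norm (x - x'))\<^sup>2 / (2 * h\<^sup>2 * (sigma \<kappa> \<rho> x)\<^sup>2))"

definition attraction ::
  "(real^'d) set \<Rightarrow> (real^'d \<Rightarrow> real) \<Rightarrow> real \<Rightarrow> real \<Rightarrow> (real^'d \<Rightarrow> real^'m) \<Rightarrow> ennreal" where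
  "attraction \<Omega> \<rho> \<kappa> h T =
     (\<integral>\<^sup>+x. (\<integral>\<^sup>+x'. ennreal (kernel \<kappa> \<rho> h x x' * ln (1 + (norm (T x - T x'))\<^sup>2) * \<rho> x') \<partial>lebesgue_on \<Omega>)
          / (\<integral>\<^sup>+x'. ennreal (kernel \<kappa> \<rho> h x x' * \<rho> x') \<partial>lebesgue_on \<Omega>)
          * ennreal (\<rho> x) \<partial>lebesgue_on \<Omega>)"

text \<open>
  The double integral below lies in $(0,1]$ for measurable \<open>T\<close> and a probability density \<open>\<rho>\<close>, so
  the repulsion is a finite real number.
\<close>
definition repulsion ::
  "(real^'d) set \<Rightarrow> (real^'d \<Rightarrow> real) \<Rightarrow> (real^'d \<Rightarrow> real^'m) \<Rightarrow> real" where
  "repulsion \<Omega> \<rho> T =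
     ln (LINT x|lebesgue_on \<Omega>. LINT x'|lebesgue_on \<Omega>.
           1 / (1 + (norm (T x - T x'))\<^sup>2) * \<rho> x * \<rho> x')"

definition energy ::
  "(real^'d) set \<Rightarrow> (real^'d \<Rightarrow> real) \<Rightarrow> real \<Rightarrow> real \<Rightarrow> (real^'d \<Rightarrow> real^'m) \<Rightarrow> ereal" where
  "energy \<Omega> \<rho> \<kappa> h T = enn2ereal (attraction \<Omega> \<rho> \<kappa> h T) + ereal (repulsion \<Omega> \<rho> T)"

definition energy_minimizer ::
  "(real^'d) set \<Rightarrow> (real^'d \<Rightarrow> real) \<Rightarrow> real \<Rightarrow> real \<Rightarrow> (real^'d \<Rightarrow> real^'m) \<Rightarrow> bool" where
  "energy_minimizer \<Omega> \<rho> \<kappa> h T \<longleftrightarrow> T \<in> borel_measurable (lebesgue_on \<Omega>) \<and>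
     (\<forall>S :: real^'d \<Rightarrow> real^'m. S \<in> borel_measurable (lebesgue_on \<Omega>) \<longrightarrow>
        energy \<Omega> \<rho> \<kappa> h T \<le> energy \<Omega> \<rho> \<kappa> h S)"

definition L_infinity :: "'a::euclidean_space set \<Rightarrow> ('a \<Rightarrow> 'b::euclidean_space) set" where
  "L_infinity \<Omega> = {f \<in> borel_measurable (lebesgue_on \<Omega>).
     \<exists>C. AE x in lebesgue_on \<Omega>. norm (f x) \<le> C}"

end

theory Submission
  imports Defs "HOL-Probability.Probability_Measure"
begin

text \<open>
  The attraction and the repulsion act on different scales. For a fixed bounded continuous map
  \<open>S\<close> the attraction only compares \<open>S\<close> at points about \<open>h\<close>
  apart, so it vanishes as \<open>h\<close> tends to zero. The repulsion does not see
  \<open>h\<close> at all: it is the logarithm of the average over independent points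
  \<open>x\<close>, \<open>y\<close> of \<open>1 / (1 + |S x - S y|\<^sup>2)\<close>, and replacing
  \<open>S\<close> by a large multiple of itself makes this average as small as one likes, provided
  that almost all pairs of points are separated by \<open>S\<close>. A linear coordinate function
  separates almost all pairs, because hyperplanes are negligible. Choosing first the multiple and
  then \<open>h\<close> small, the minimal energy tends to minus infinity
  (\<open>exists_low_energy\<close>).

  Along minimizers with an almost everywhere limit this is impossible. The attraction is
  nonnegative, so the energy is at least the repulsion, and by dominated convergence the repulsion
  of the maps converges to the repulsion of the limit (\<open>repulsion_tendsto\<close>). The latter is finite:
  the average of a strictly positive function with respect to a probability measure is positive.

  Everything takes place with respect to the probability measure \<open>\<mu>\<close> with density \<open>\<rho>\<close> on the
  domain. The analytic core is \<open>gaussian_average_tendsto_0\<close>, the concentration of normalized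
  Gaussian weights at a point of the support of a measure.
\<close>

section \<open>Mean proximity of the images of two random points\<close>

definition mean_proximity :: "'a measure \<Rightarrow> ('a \<Rightarrow> 'b::euclidean_space) \<Rightarrow> real" where
  "mean_proximity M T = (LINT x|M. LINT y|M. 1 / (1 + (norm (T x - T y))\<^sup>2))"

lemma proximity_bounds:
  fixes z :: "'b::real_normed_vector"
  shows "0 < 1 / (1 + (norm z)\<^sup>2)" "1 / (1 + (norm z)\<^sup>2) \<le> 1"
  by (simp_all add: add_pos_nonneg)

lemma (in prob_space) integral_tendsto_unit_bounded:
  fixes f :: "nat \<Rightarrow> 'a \<Rightarrow> real"
  assumes [measurable]: "\<And>n. f n \<in> borel_measurable M" "g \<in> borel_measurable M"
    and "\<And>n x. \<bar>f n x\<bar> \<le> 1" and "AE x in M. (\<lambda>n. f n x) \<longlonglongrightarrow> g x"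
  shows "(\<lambda>n. \<integral>x. f n x \<partial>M) \<longlonglongrightarrow> (\<integral>x. g x \<partial>M)"
  by (rule integral_dominated_convergence[where w = "\<lambda>_. 1"]) (use assms in auto)

lemma (in prob_space) integral_unit_bounds:
  fixes f :: "'a \<Rightarrow> real"
  assumes "\<And>x. 0 \<le> f x" "\<And>x. f x \<le> 1"
  shows "0 \<le> (\<integral>x. f x \<partial>M)" "(\<integral>x. f x \<partial>M) \<le> 1"
proof -
  show "0 \<le> (\<integral>x. f x \<partial>M)" using assms by simp
  show "(\<integral>x. f x \<partial>M) \<le> 1"
  proof (cases "integrable M f")
    case True
    then show ?thesis using assms by (intro integral_le_const) auto
  next
    case False
    then show ?thesis by (simp add: not_integrable_integral_eq)
  qed
qed

text \<open>
  The limit is taken in the inner integral first, for almost every outer point; the inner integrals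
  are then again bounded by one. The limit is assumed slice by slice because that is
  how an almost everywhere limit of maps yields it.
\<close>
lemma (in prob_space) double_integral_tendsto_unit_bounded:
  fixes f :: "nat \<Rightarrow> 'a \<Rightarrow> 'a \<Rightarrow> real"
  assumes [measurable]: "\<And>n. case_prod (f n) \<in> borel_measurable (M \<Otimes>\<^sub>M M)"
      "case_prod g \<in> borel_measurable (M \<Otimes>\<^sub>M M)"
    and bounds: "\<And>n x y. 0 \<le> f n x y" "\<And>n x y. f n x y \<le> 1"
    and lim: "AE x in M. AE y in M. (\<lambda>n. f n x y) \<longlonglongrightarrow> g x y"
  shows "(\<lambda>n. \<integral>x. \<integral>y. f n x y \<partial>M \<partial>M) \<longlonglongrightarrow> (\<integral>x. \<integral>y. g x y \<partial>M \<partial>M)"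
proof (rule integral_tendsto_unit_bounded)
  show "AE x in M. (\<lambda>n. \<integral>y. f n x y \<partial>M) \<longlonglongrightarrow> (\<integral>y. g x y \<partial>M)"
    using lim AE_space
  proof eventually_elim
    case (elim x)
    then have [measurable]: "x \<in> space M" by simp
    show ?case
      by (rule integral_tendsto_unit_bounded) (use elim bounds in \<open>auto simp: abs_le_iff intro: order_trans[OF _ bounds(1)]\<close>)
  qed
  show "\<bar>\<integral>y. f n x y \<partial>M\<bar> \<le> 1" for n x
    using integral_unit_bounds[of "f n x"] bounds by simp
qed measurable

lemma (in prob_space) mean_proximity_tendsto:
  fixes T :: "nat \<Rightarrow> 'a \<Rightarrow> 'b::euclidean_space"
  assumes [measurable]: "\<And>n. T n \<in> borel_measurable M" "S \<in> borel_measurable M"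
    and lim: "AE x in M. (\<lambda>n. T n x) \<longlonglongrightarrow> S x"
  shows "(\<lambda>n. mean_proximity M (T n)) \<longlonglongrightarrow> mean_proximity M S"
  unfolding mean_proximity_def
proof (rule double_integral_tendsto_unit_bounded)
  show "AE x in M. AE y in M.
    (\<lambda>n. 1 / (1 + (norm (T n x - T n y))\<^sup>2)) \<longlonglongrightarrow> 1 / (1 + (norm (S x - S y))\<^sup>2)"
    using lim
  proof eventually_elim
    case x: (elim x)
    show ?case using lim
    proof eventually_elim
      case (elim y)
      have "1 + (norm (S x - S y))\<^sup>2 \<noteq> 0"
        using zero_le_power2[of "norm (S x - S y)"] by linarith
      then show ?case using x elim by (intro tendsto_intros)
    qed
  qed
qed (use proximity_bounds in \<open>auto simp: less_imp_le\<close>)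

lemma (in prob_space) mean_proximity_pos:
  fixes T :: "'a \<Rightarrow> 'b::euclidean_space"
  assumes [measurable]: "T \<in> borel_measurable M"
  shows "0 < mean_proximity M T"
proof -
  have pos: "0 < (\<integral>x. f x \<partial>M)"
    if [measurable]: "f \<in> borel_measurable M" and "\<And>x. x \<in> space M \<Longrightarrow> 0 < f x" "\<And>x. f x \<le> 1" "\<And>x. 0 \<le> f x"
    for f :: "'a \<Rightarrow> real"
  proof -
    have "integrable M f"
      by (rule integrable_const_bound[where B = 1]) (use that in auto)
    then have "(\<integral>x. 0 \<partial>M) < (\<integral>x. f x \<partial>M)"
      using that emeasure_space_1 by (intro integral_less_AE_space) auto
    then show ?thesis by simp
  qed
  let ?p = "\<lambda>x y. 1 / (1 + (norm (T x - T y))\<^sup>2)"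
  have p: "0 < ?p x y" "0 \<le> ?p x y" "?p x y \<le> 1" for x y
    using proximity_bounds[of "T x - T y"] by (auto simp: less_imp_le)
  have inner_pos: "0 < (\<integral>y. ?p x y \<partial>M)" if [measurable]: "x \<in> space M" for x
    by (rule pos[OF _ p(1) p(3) p(2)]) measurable
  have inner_bounds: "0 \<le> (\<integral>y. ?p x y \<partial>M)" "(\<integral>y. ?p x y \<partial>M) \<le> 1" for x
    using integral_unit_bounds[of "?p x"] p by auto
  have inner_meas: "(\<lambda>x. \<integral>y. ?p x y \<partial>M) \<in> borel_measurable M"
    by measurable
  show ?thesis
    unfolding mean_proximity_def
    by (rule pos[OF inner_meas inner_pos inner_bounds(2) inner_bounds(1)])
qed

text \<open>
  Stretching pushes two distinct image points infinitely far apart, so the integrand tends to zero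
  at almost all pairs.
\<close>
lemma (in prob_space) mean_proximity_scaled_tendsto_0:
  fixes S :: "'a \<Rightarrow> 'b::euclidean_space"
  assumes [measurable]: "S \<in> borel_measurable M"
    and null: "AE x in M. AE y in M. S x \<noteq> S y"
  shows "(\<lambda>n. mean_proximity M (\<lambda>x. real n *\<^sub>R S x)) \<longlonglongrightarrow> 0"
proof -
  let ?p = "\<lambda>n x y. 1 / (1 + (norm (real n *\<^sub>R S x - real n *\<^sub>R S y))\<^sup>2)"
  have lim: "(\<lambda>n. ?p n x y) \<longlonglongrightarrow> 0" if "S x \<noteq> S y" for x y
  proof -
    have "filterlim (\<lambda>n. norm (S x - S y) * real n) at_top sequentially"
      using that by (intro filterlim_tendsto_pos_mult_at_top[OF tendsto_const _ filterlim_real_sequentially]) auto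
    then have "filterlim (\<lambda>n. 1 + (norm (S x - S y) * real n)\<^sup>2) at_top sequentially"
      by (intro filterlim_tendsto_add_at_top[OF tendsto_const] filterlim_pow_at_top) auto
    then have "(\<lambda>n. inverse (1 + (norm (S x - S y) * real n)\<^sup>2)) \<longlonglongrightarrow> 0"
      by (rule tendsto_inverse_0_at_top)
    then show ?thesis
      by (simp add: divide_inverse scaleR_diff_right[symmetric] mult.commute)
  qed
  have "(\<lambda>n. \<integral>x. \<integral>y. ?p n x y \<partial>M \<partial>M) \<longlonglongrightarrow> (\<integral>x. \<integral>y. 0 \<partial>M \<partial>M)"
  proof (rule double_integral_tendsto_unit_bounded)
    show "AE x in M. AE y in M. (\<lambda>n. ?p n x y) \<longlonglongrightarrow> 0"
      using null by eventually_elim (auto elim!: eventually_mono intro: lim)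
  qed (use proximity_bounds in \<open>auto simp: less_imp_le\<close>)
  then show ?thesis by (simp add: mean_proximity_def)
qed

section \<open>Concentration of Gaussian averages\<close>

text \<open>
  Fix \<open>e\<close> and a radius \<open>r\<close> within which \<open>g \<le> e\<close>. Points closer than \<open>r\<close> contribute at most
  \<open>e\<close> times the normalization, the others at most \<open>B exp (- r\<^sup>2 / (2 s\<^sup>2))\<close>. The normalization is
  itself exponentially small, but at a slower rate: the points within \<open>r / 2\<close> have positive mass
  and weights at least \<open>exp (- r\<^sup>2 / (8 s\<^sup>2))\<close>. The quotient of the two exponentials tends to zero.
\<close>
lemma (in prob_space) gaussian_average_tendsto_0:
  fixes x :: "'b::euclidean_space" and p :: "'a \<Rightarrow> 'b"
  assumes [measurable]: "p \<in> borel_measurable M" "g \<in> borel_measurable M"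
    and g: "\<And>y. y \<in> space M \<Longrightarrow> 0 \<le> g y" "\<And>y. y \<in> space M \<Longrightarrow> g y \<le> B"
    and supp: "\<And>r. r > 0 \<Longrightarrow> 0 < measure M {y \<in> space M. norm (x - p y) < r}"
    and small: "\<And>e. e > 0 \<Longrightarrow> \<exists>r>0. \<forall>y\<in>space M. norm (x - p y) < r \<longrightarrow> g y \<le> e"
    and s: "\<And>n. s n > 0" "s \<longlonglongrightarrow> 0"
  shows "(\<lambda>n. (\<integral>\<^sup>+y. ennreal (exp (- (norm (x - p y))\<^sup>2 / (2 * (s n)\<^sup>2)) * g y) \<partial>M)
           / (\<integral>\<^sup>+y. ennreal (exp (- (norm (x - p y))\<^sup>2 / (2 * (s n)\<^sup>2))) \<partial>M)) \<longlonglongrightarrow> 0"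
proof -
  define k where "k n y = exp (- (norm (x - p y))\<^sup>2 / (2 * (s n)\<^sup>2))" for n y
  have [measurable]: "k n \<in> borel_measurable M" for n
    unfolding k_def by measurable
  have k: "0 < k n y" "k n y \<le> 1" for n y
    by (auto simp: k_def)
  have B: "0 \<le> B" using g not_empty by (meson all_not_in_conv order_trans)
  define N where "N n = (\<integral>y. k n y * g y \<partial>M)" for n
  define D where "D n = (\<integral>y. k n y \<partial>M)" for n
  have int_k: "integrable M (k n)" for n
    by (rule integrable_const_bound[where B = 1]) (use k in \<open>auto simp: less_imp_le\<close>)
  have int_kg: "integrable M (\<lambda>y. k n y * g y)" for n
  proof (rule integrable_const_bound[where B = B])
    show "AE y in M. norm (k n y * g y) \<le> B"
    proof (rule AE_I2)
      fix y assume "y \<in> space M"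
      then have "k n y * g y \<le> 1 * B" using k[of n y] g[of y] by (intro mult_mono) auto
      then show "norm (k n y * g y) \<le> B"
        using k[of n y] g[of y] \<open>y \<in> space M\<close> by simp
    qed
  qed measurable
  have D_lower: "exp (- (r/2)\<^sup>2 / (2 * (s n)\<^sup>2)) * measure M {y \<in> space M. norm (x - p y) < r/2} \<le> D n"
    for n r
  proof -
    let ?A = "{y \<in> space M. norm (x - p y) < r/2}"
    have "(\<integral>y. exp (- (r/2)\<^sup>2 / (2 * (s n)\<^sup>2)) * indicator ?A y \<partial>M) \<le> D n"
      unfolding D_def
    proof (rule integral_mono[OF _ int_k])
      show "integrable M (\<lambda>y. exp (- (r/2)\<^sup>2 / (2 * (s n)\<^sup>2)) * indicator ?A y)"
        by (intro integrable_mult_right integrable_real_indicator) (auto simp: emeasure_eq_measure)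
      fix y assume "y \<in> space M"
      show "exp (- (r/2)\<^sup>2 / (2 * (s n)\<^sup>2)) * indicator ?A y \<le> k n y"
        using k(1)[of n y] s(1)[of n]
        by (auto simp: k_def indicator_def intro!: divide_right_mono power_mono)
    qed
    then show ?thesis by (simp add: integral_indicator emeasure_eq_measure)
  qed
  have D_pos: "D n > 0" for n
    by (rule less_le_trans[OF _ D_lower[of 2 n]]) (use supp[of 1] in simp)
  have N_upper: "N n \<le> e * D n + exp (- r\<^sup>2 / (2 * (s n)\<^sup>2)) * B"
    if r: "r > 0" "\<And>y. y \<in> space M \<Longrightarrow> norm (x - p y) < r \<Longrightarrow> g y \<le> e" and "e > 0" for e r n
  proof -
    have "N n \<le> (\<integral>y. e * k n y + exp (- r\<^sup>2 / (2 * (s n)\<^sup>2)) * B \<partial>M)"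
      unfolding N_def
    proof (rule integral_mono[OF int_kg])
      show "integrable M (\<lambda>y. e * k n y + exp (- r\<^sup>2 / (2 * (s n)\<^sup>2)) * B)"
        using int_k by auto
      fix y assume y: "y \<in> space M"
      show "k n y * g y \<le> e * k n y + exp (- r\<^sup>2 / (2 * (s n)\<^sup>2)) * B"
      proof (cases "norm (x - p y) < r")
        case True
        then have "k n y * g y \<le> k n y * e"
          using r(2)[OF y True] k(1)[of n y] by simp
        moreover have "0 \<le> exp (- r\<^sup>2 / (2 * (s n)\<^sup>2)) * B" using B by simp
        ultimately show ?thesis by (simp add: mult.commute)
      next
        case False
        then have "k n y \<le> exp (- r\<^sup>2 / (2 * (s n)\<^sup>2))"
          using r(1) s(1)[of n] by (auto simp: k_def intro!: divide_right_mono power_mono)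
        then have "k n y * g y \<le> exp (- r\<^sup>2 / (2 * (s n)\<^sup>2)) * B"
          using g[OF y] by (intro mult_mono) auto
        moreover have "0 \<le> e * k n y" using k(1)[of n y] \<open>e > 0\<close> by simp
        ultimately show ?thesis by simp
      qed
    qed
    also have "\<dots> = e * D n + exp (- r\<^sup>2 / (2 * (s n)\<^sup>2)) * B"
      using int_k by (simp add: D_def prob_space)
    finally show ?thesis .
  qed
  have "(\<lambda>n. N n / D n) \<longlonglongrightarrow> 0"
  proof (rule order_tendstoI)
    fix a :: real assume "a < 0"
    have "0 \<le> N n / D n" for n
      using D_pos[of n] k g by (auto simp: N_def less_imp_le intro!: divide_nonneg_pos integral_nonneg_AE AE_I2)
    then show "\<forall>\<^sub>F n in sequentially. a < N n / D n"
      using \<open>a < 0\<close> by (intro always_eventually allI) (meson less_le_trans)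
  next
    fix a :: real assume "0 < a"
    then obtain r where r: "r > 0" "\<And>y. y \<in> space M \<Longrightarrow> norm (x - p y) < r \<Longrightarrow> g y \<le> a/2"
      using small[of "a/2"] by auto
    define c where "c = measure M {y \<in> space M. norm (x - p y) < r/2}"
    have c: "c > 0" using supp[of "r/2"] r(1) by (simp add: c_def)
    have bound: "N n / D n \<le> a/2 + B / c * exp (- (3/8 * r\<^sup>2) * (inverse (s n))\<^sup>2)" for n
    proof -
      let ?E = "exp (- (r/2)\<^sup>2 / (2 * (s n)\<^sup>2))" and ?F = "exp (- r\<^sup>2 / (2 * (s n)\<^sup>2))"
      have "N n / D n \<le> a/2 + ?F * B / D n"
        using N_upper[of r "a/2" n] r \<open>0 < a\<close> D_pos[of n] by (simp add: field_simps)
      also have "?F * B / D n \<le> ?F * B / (?E * c)"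
        using D_lower[of r n] c B D_pos[of n] by (intro divide_left_mono) (auto simp: c_def)
      also have "?F * B / (?E * c) = B / c * exp (- r\<^sup>2 / (2 * (s n)\<^sup>2) - - (r/2)\<^sup>2 / (2 * (s n)\<^sup>2))"
        by (simp only: exp_diff) (simp add: field_simps)
      also have "- r\<^sup>2 / (2 * (s n)\<^sup>2) - - (r/2)\<^sup>2 / (2 * (s n)\<^sup>2) = - (3/8 * r\<^sup>2) * (inverse (s n))\<^sup>2"
        using s(1)[of n] by (simp add: field_simps)
      finally show ?thesis by simp
    qed
    have "filterlim (\<lambda>n. inverse (s n)) at_top sequentially"
      using s by (intro filterlim_inverse_at_top) auto
    then have "filterlim (\<lambda>n. (inverse (s n))\<^sup>2) at_top sequentially"
      by (intro filterlim_pow_at_top) auto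
    then have "filterlim (\<lambda>n. - (3/8 * r\<^sup>2) * (inverse (s n))\<^sup>2) at_bot sequentially"
      using r(1) by (intro filterlim_tendsto_neg_mult_at_bot[OF tendsto_const]) auto
    then have "(\<lambda>n. exp (- (3/8 * r\<^sup>2) * (inverse (s n))\<^sup>2)) \<longlonglongrightarrow> 0"
      by (rule filterlim_compose[OF exp_at_bot])
    then have "(\<lambda>n. a/2 + B / c * exp (- (3/8 * r\<^sup>2) * (inverse (s n))\<^sup>2)) \<longlonglongrightarrow> a/2 + B / c * 0"
      by (intro tendsto_intros)
    then have "\<forall>\<^sub>F n in sequentially. a/2 + B / c * exp (- (3/8 * r\<^sup>2) * (inverse (s n))\<^sup>2) < a"
      by (rule order_tendstoD(2)) (use \<open>0 < a\<close> in simp)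
    then show "\<forall>\<^sub>F n in sequentially. N n / D n < a"
      by eventually_elim (use bound le_less_trans in blast)
  qed
  then have "(\<lambda>n. ennreal (N n / D n)) \<longlonglongrightarrow> ennreal 0"
    by (rule tendsto_ennrealI)
  moreover have "ennreal (N n / D n) =
      (\<integral>\<^sup>+y. ennreal (k n y * g y) \<partial>M) / (\<integral>\<^sup>+y. ennreal (k n y) \<partial>M)" for n
  proof -
    have "(\<integral>\<^sup>+y. ennreal (k n y * g y) \<partial>M) = ennreal (N n)"
      unfolding N_def using k g by (intro nn_integral_eq_integral int_kg AE_I2) (auto simp: less_imp_le)
    moreover have "(\<integral>\<^sup>+y. ennreal (k n y) \<partial>M) = ennreal (D n)"
      unfolding D_def using k by (intro nn_integral_eq_integral int_k AE_I2) (auto simp: less_imp_le)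
    moreover have "0 \<le> N n"
      unfolding N_def using k g by (auto simp: less_imp_le intro!: integral_nonneg_AE AE_I2)
    ultimately show ?thesis using D_pos[of n] by (simp add: divide_ennreal)
  qed
  ultimately show ?thesis by (simp add: k_def)
qed

section \<open>The energy in terms of the data distribution\<close>

locale positive_density =
  fixes \<Omega> :: "(real^'d) set" and \<rho> :: "real^'d \<Rightarrow> real"
  assumes open_domain: "open \<Omega>"
    and density: "prob_density_on \<Omega> \<rho>"
    and pos: "\<And>x. x \<in> \<Omega> \<Longrightarrow> 0 < \<rho> x"
begin

definition \<mu> :: "(real^'d) measure" where
  "\<mu> = density (lebesgue_on \<Omega>) (\<lambda>x. ennreal (\<rho> x))"

lemma domain_sets [measurable]: "\<Omega> \<in> sets lebesgue"
  using open_domain by simp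

lemma density_measurable [measurable]: "\<rho> \<in> borel_measurable (lebesgue_on \<Omega>)"
  using density by (simp add: prob_density_on_def)

lemma sets_\<mu> [measurable_cong]: "sets \<mu> = sets (lebesgue_on \<Omega>)"
  by (simp add: \<mu>_def)

lemma space_\<mu> [simp]: "space \<mu> = \<Omega>"
  by (simp add: \<mu>_def)

lemma borel_measurable_\<mu>: "borel_measurable \<mu> = borel_measurable (lebesgue_on \<Omega>)"
  by (rule measurable_cong_sets) (simp_all add: sets_\<mu>)

lemma ident_measurable [measurable]: "(\<lambda>x. x) \<in> borel_measurable (lebesgue_on \<Omega>)"
  by (intro measurable_restrict_space1 measurable_completion) simp

sublocale prob_space \<mu>
proof
  have "emeasure \<mu> (space \<mu>) = (\<integral>\<^sup>+x. ennreal (\<rho> x) * indicator \<Omega> x \<partial>lebesgue_on \<Omega>)"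
    unfolding space_\<mu> unfolding \<mu>_def
    by (rule emeasure_density) (auto simp: sets_restrict_space)
  also have "\<dots> = (\<integral>\<^sup>+x. ennreal (\<rho> x) \<partial>lebesgue_on \<Omega>)"
    by (rule nn_integral_cong) simp
  finally show "emeasure \<mu> (space \<mu>) = 1"
    using density by (simp add: prob_density_on_def)
qed

lemma AE_\<mu>_iff: "(AE x in \<mu>. P x) \<longleftrightarrow> (AE x in lebesgue_on \<Omega>. P x)"
proof -
  have "(AE x in \<mu>. P x) \<longleftrightarrow> (AE x in lebesgue_on \<Omega>. 0 < ennreal (\<rho> x) \<longrightarrow> P x)"
    unfolding \<mu>_def by (rule AE_density) measurable
  also have "\<dots> \<longleftrightarrow> (AE x in lebesgue_on \<Omega>. P x)"
    by (rule AE_cong) (simp add: pos)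
  finally show ?thesis .
qed

lemma AE_\<mu>_not_in_negligible:
  assumes "negligible N"
  shows "AE x in \<mu>. x \<notin> N"
proof -
  have "AE x in lebesgue. x \<notin> N"
    using assms by (intro AE_not_in) (simp add: negligible_iff_null_sets)
  then show ?thesis
    unfolding AE_\<mu>_iff by (subst AE_restrict_space_iff) auto
qed

text \<open>
  A nonempty open set is not negligible, and the density is positive on it. This makes every point
  of the domain a point at which \<open>gaussian_average_tendsto_0\<close> applies.
\<close>
lemma measure_ball_pos:
  assumes "x \<in> \<Omega>" "0 < r"
  shows "0 < measure \<mu> {y \<in> \<Omega>. norm (x - y) < r}"
proof (rule ccontr)
  let ?A = "{y \<in> \<Omega>. norm (x - y) < r}"
  have A: "?A = \<Omega> \<inter> ball x r"
    by (auto simp: dist_norm)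
  have [measurable]: "?A \<in> sets \<mu>"
    unfolding A sets_\<mu> using open_domain by (auto simp: sets_restrict_space)
  assume "\<not> 0 < measure \<mu> ?A"
  then have "AE y in \<mu>. y \<notin> ?A"
    by (intro AE_not_in) (simp add: null_sets_def emeasure_eq_measure zero_less_measure_iff)
  then have "AE y in lebesgue. y \<notin> ?A"
    unfolding AE_\<mu>_iff by (subst (asm) AE_restrict_space_iff) auto
  then have "negligible ?A"
    using open_domain unfolding A by (subst negligible_iff_null_sets) (simp add: AE_iff_null_sets)
  moreover have "open ?A" "x \<in> ?A"
    using open_domain assms unfolding A by auto
  ultimately show False
    using open_not_negligible by blast
qed

lemma nn_integral_\<mu>:
  assumes "g \<in> borel_measurable (lebesgue_on \<Omega>)" and "\<And>x. x \<in> \<Omega> \<Longrightarrow> 0 \<le> g x"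
  shows "(\<integral>\<^sup>+x. ennreal (g x * \<rho> x) \<partial>lebesgue_on \<Omega>) = (\<integral>\<^sup>+x. ennreal (g x) \<partial>\<mu>)"
proof -
  have "(\<integral>\<^sup>+x. ennreal (g x) \<partial>\<mu>) = (\<integral>\<^sup>+x. ennreal (\<rho> x) * ennreal (g x) \<partial>lebesgue_on \<Omega>)"
    unfolding \<mu>_def using assms(1) by (intro nn_integral_density) measurable
  also have "\<dots> = (\<integral>\<^sup>+x. ennreal (g x * \<rho> x) \<partial>lebesgue_on \<Omega>)"
    using assms(2) by (intro nn_integral_cong) (simp add: ennreal_mult pos less_imp_le mult.commute)
  finally show ?thesis by simp
qed

lemma kernel_measurable [measurable]:
  "(\<lambda>(x, y). kernel \<kappa> \<rho> h x y) \<in> borel_measurable (lebesgue_on \<Omega> \<Otimes>\<^sub>M lebesgue_on \<Omega>)"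
  unfolding kernel_def sigma_def by measurable

lemma kernel_bounds: "0 < kernel \<kappa> \<rho> h x y" "kernel \<kappa> \<rho> h x y \<le> 1"
  by (simp_all add: kernel_def)

lemma repulsion_eq:
  assumes [measurable]: "T \<in> borel_measurable (lebesgue_on \<Omega>)"
  shows "repulsion \<Omega> \<rho> T = ln (mean_proximity \<mu> T)"
proof -
  let ?p = "\<lambda>x y. 1 / (1 + (norm (T x - T y))\<^sup>2)"
  have [simp]: "AE x in lebesgue_on \<Omega>. 0 \<le> \<rho> x"
    by (rule AE_I2) (simp add: pos less_imp_le)
  have "mean_proximity \<mu> T = (\<integral>x. \<rho> x * (\<integral>y. ?p x y \<partial>\<mu>) \<partial>lebesgue_on \<Omega>)"
    unfolding mean_proximity_def
    by (subst (1) \<mu>_def, rule integral_real_density) measurable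
  also have "\<dots> = (\<integral>x. (\<integral>y. ?p x y * \<rho> x * \<rho> y \<partial>lebesgue_on \<Omega>) \<partial>lebesgue_on \<Omega>)"
  proof (rule Bochner_Integration.integral_cong[OF refl])
    fix x assume "x \<in> space (lebesgue_on \<Omega>)"
    then have [measurable]: "x \<in> \<Omega>" by simp
    have "(\<integral>y. ?p x y \<partial>\<mu>) = (\<integral>y. \<rho> y * ?p x y \<partial>lebesgue_on \<Omega>)"
      unfolding \<mu>_def by (rule integral_real_density) measurable
    then show "\<rho> x * (\<integral>y. ?p x y \<partial>\<mu>) = (\<integral>y. ?p x y * \<rho> x * \<rho> y \<partial>lebesgue_on \<Omega>)"
      by (simp add: mult_ac flip: integral_mult_right_zero)
  qed
  finally show ?thesis
    by (simp add: repulsion_def)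
qed

definition local_spread :: "real \<Rightarrow> real \<Rightarrow> (real^'d \<Rightarrow> real^'m) \<Rightarrow> real^'d \<Rightarrow> ennreal" where
  "local_spread \<kappa> h T x =
     (\<integral>\<^sup>+y. ennreal (kernel \<kappa> \<rho> h x y * ln (1 + (norm (T x - T y))\<^sup>2)) \<partial>\<mu>)
       / (\<integral>\<^sup>+y. ennreal (kernel \<kappa> \<rho> h x y) \<partial>\<mu>)"

lemma local_spread_measurable [measurable]:
  assumes [measurable]: "T \<in> borel_measurable (lebesgue_on \<Omega>)"
  shows "local_spread \<kappa> h T \<in> borel_measurable (lebesgue_on \<Omega>)"
  unfolding local_spread_def by measurable

lemma attraction_eq:
  assumes [measurable]: "T \<in> borel_measurable (lebesgue_on \<Omega>)"
  shows "attraction \<Omega> \<rho> \<kappa> h T = (\<integral>\<^sup>+x. local_spread \<kappa> h T x \<partial>\<mu>)"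
proof -
  have "(\<integral>\<^sup>+x. local_spread \<kappa> h T x \<partial>\<mu>)
      = (\<integral>\<^sup>+x. ennreal (\<rho> x) * local_spread \<kappa> h T x \<partial>lebesgue_on \<Omega>)"
    by (subst \<mu>_def, rule nn_integral_density) measurable
  also have "\<dots> = attraction \<Omega> \<rho> \<kappa> h T"
    unfolding attraction_def
  proof (rule nn_integral_cong)
    fix x assume "x \<in> space (lebesgue_on \<Omega>)"
    then have [measurable]: "x \<in> space (lebesgue_on \<Omega>)" .
    have "(\<integral>\<^sup>+y. ennreal (kernel \<kappa> \<rho> h x y * ln (1 + (norm (T x - T y))\<^sup>2) * \<rho> y) \<partial>lebesgue_on \<Omega>)
        = (\<integral>\<^sup>+y. ennreal (kernel \<kappa> \<rho> h x y * ln (1 + (norm (T x - T y))\<^sup>2)) \<partial>\<mu>)"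
      by (rule nn_integral_\<mu>) (auto simp: kernel_bounds less_imp_le)
    moreover have "(\<integral>\<^sup>+y. ennreal (kernel \<kappa> \<rho> h x y * \<rho> y) \<partial>lebesgue_on \<Omega>)
        = (\<integral>\<^sup>+y. ennreal (kernel \<kappa> \<rho> h x y) \<partial>\<mu>)"
      by (rule nn_integral_\<mu>) (auto simp: kernel_bounds less_imp_le)
    ultimately show "ennreal (\<rho> x) * local_spread \<kappa> h T x =
       (\<integral>\<^sup>+y. ennreal (kernel \<kappa> \<rho> h x y * ln (1 + (norm (T x - T y))\<^sup>2) * \<rho> y) \<partial>lebesgue_on \<Omega>)
          / (\<integral>\<^sup>+y. ennreal (kernel \<kappa> \<rho> h x y * \<rho> y) \<partial>lebesgue_on \<Omega>) * ennreal (\<rho> x)"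
      by (simp add: local_spread_def mult.commute)
  qed
  finally show ?thesis by simp
qed

section \<open>Vanishing attraction and unbounded repulsion\<close>

text \<open>
  At each \<open>x\<close> the local spread is a Gaussian average of \<open>\<lambda>y. ln (1 + |S x - S y|\<^sup>2)\<close>, which is
  continuous and vanishes at \<open>x\<close>; its width \<open>h * sigma \<kappa> \<rho> x\<close> tends to zero. As a weighted
  average the local spread never exceeds the supremum of that function, so dominated convergence
  applies to the integral over \<open>x\<close>.
\<close>
lemma attraction_tendsto_0:
  fixes S :: "real^'d \<Rightarrow> real^'m"
  assumes cont: "continuous_on \<Omega> S" and bound: "\<And>x. x \<in> \<Omega> \<Longrightarrow> norm (S x) \<le> C"
    and \<kappa>: "0 < \<kappa>" and h: "\<And>n. 0 < h n" "h \<longlonglongrightarrow> 0"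
  shows "(\<lambda>n. attraction \<Omega> \<rho> \<kappa> (h n) S) \<longlonglongrightarrow> 0"
proof -
  have [measurable]: "S \<in> borel_measurable (lebesgue_on \<Omega>)"
    using cont by (intro continuous_imp_measurable_on_sets_lebesgue) auto
  define B where "B = ln (1 + (2 * C)\<^sup>2)"
  define g where "g x y = ln (1 + (norm (S x - S y))\<^sup>2)" for x y
  have g: "0 \<le> g x y" "g x y \<le> B" if "x \<in> \<Omega>" "y \<in> \<Omega>" for x y
  proof -
    have "norm (S x - S y) \<le> 2 * C"
      using norm_triangle_ineq4[of "S x" "S y"] bound[OF that(1)] bound[OF that(2)] by linarith
    then have "(norm (S x - S y))\<^sup>2 \<le> (2 * C)\<^sup>2"
      by (intro power_mono) auto
    then show "g x y \<le> B"
      unfolding g_def B_def by (subst ln_le_cancel_iff) (auto intro: add_pos_nonneg)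
  qed (simp add: g_def)
  have le_B: "local_spread \<kappa> (h n) S x \<le> ennreal B" if x: "x \<in> \<Omega>" for n x
  proof -
    have [measurable]: "x \<in> space (lebesgue_on \<Omega>)" using x by simp
    let ?D = "\<integral>\<^sup>+y. ennreal (kernel \<kappa> \<rho> (h n) x y) \<partial>\<mu>"
    have "(\<integral>\<^sup>+y. ennreal (kernel \<kappa> \<rho> (h n) x y * g x y) \<partial>\<mu>)
        \<le> (\<integral>\<^sup>+y. ennreal B * ennreal (kernel \<kappa> \<rho> (h n) x y) \<partial>\<mu>)"
    proof (rule nn_integral_mono)
      fix y assume "y \<in> space \<mu>"
      then have "kernel \<kappa> \<rho> (h n) x y * g x y \<le> B * kernel \<kappa> \<rho> (h n) x y" "0 \<le> B"
        using g[OF x, of y] kernel_bounds(1)[of \<kappa> "h n" x y] by (auto simp: mult.commute)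
      then show "ennreal (kernel \<kappa> \<rho> (h n) x y * g x y) \<le> ennreal B * ennreal (kernel \<kappa> \<rho> (h n) x y)"
        by (simp add: ennreal_mult[symmetric] kernel_bounds less_imp_le ennreal_leI)
    qed
    also have "\<dots> = ennreal B * ?D"
      by (rule nn_integral_cmult) measurable
    finally have "local_spread \<kappa> (h n) S x \<le> ennreal B * ?D / ?D"
      unfolding local_spread_def g_def by (rule divide_right_mono_ennreal)
    also have "\<dots> \<le> ennreal B"
    proof -
      have "?D \<le> (\<integral>\<^sup>+y. 1 \<partial>\<mu>)"
        by (rule nn_integral_mono) (simp add: kernel_bounds)
      then have "?D \<noteq> top"
        by (auto simp: emeasure_space_1[unfolded space_\<mu>] top_unique)
      then show ?thesis
        by (cases "?D = 0") (auto simp: mult_divide_eq_ennreal)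
    qed
    finally show ?thesis .
  qed
  have lim: "(\<lambda>n. local_spread \<kappa> (h n) S x) \<longlonglongrightarrow> 0" if x: "x \<in> \<Omega>" for x
  proof -
    have [measurable]: "x \<in> space (lebesgue_on \<Omega>)" using x by simp
    have \<sigma>: "0 < sigma \<kappa> \<rho> x"
      using \<kappa> pos[OF x] by (simp add: sigma_def)
    have "(\<lambda>n. (\<integral>\<^sup>+y. ennreal (exp (- (norm (x - y))\<^sup>2 / (2 * (h n * sigma \<kappa> \<rho> x)\<^sup>2)) * g x y) \<partial>\<mu>)
        / (\<integral>\<^sup>+y. ennreal (exp (- (norm (x - y))\<^sup>2 / (2 * (h n * sigma \<kappa> \<rho> x)\<^sup>2))) \<partial>\<mu>)) \<longlonglongrightarrow> 0"
    proof (rule gaussian_average_tendsto_0)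
      show "(\<lambda>y. y) \<in> borel_measurable \<mu>"
        by measurable
      show "g x \<in> borel_measurable \<mu>"
        unfolding g_def by measurable
      show "0 \<le> g x y" "g x y \<le> B" if "y \<in> space \<mu>" for y
        using g[OF x] that by auto
      show "0 < prob {y \<in> space \<mu>. norm (x - y) < r}" if "0 < r" for r
        using measure_ball_pos[OF x that] by simp
      show "\<exists>r>0. \<forall>y\<in>space \<mu>. norm (x - y) < r \<longrightarrow> g x y \<le> e" if "0 < e" for e
      proof -
        have "continuous_on \<Omega> (g x)"
          unfolding g_def using cont
          by (intro continuous_intros) (auto simp: add_nonneg_eq_0_iff)
        then obtain r where "0 < r" "\<forall>y\<in>\<Omega>. dist y x < r \<longrightarrow> dist (g x y) (g x x) < e"
          using x \<open>0 < e\<close> unfolding continuous_on_iff by blast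
        then show ?thesis
          by (intro exI[of _ r]) (force simp: g_def dist_norm norm_minus_commute)
      qed
      show "0 < h n * sigma \<kappa> \<rho> x" for n
        using h \<sigma> by simp
      show "(\<lambda>n. h n * sigma \<kappa> \<rho> x) \<longlonglongrightarrow> 0"
        using h by (auto intro: tendsto_mult_left_zero)
    qed
    then show ?thesis
      by (simp add: local_spread_def kernel_def g_def power_mult_distrib mult.assoc)
  qed
  have "(\<lambda>n. \<integral>\<^sup>+x. local_spread \<kappa> (h n) S x \<partial>\<mu>) \<longlonglongrightarrow> (\<integral>\<^sup>+x. 0 \<partial>\<mu>)"
  proof (rule nn_integral_dominated_convergence[where w = "\<lambda>_. ennreal B"])
    show "(\<integral>\<^sup>+x. ennreal B \<partial>\<mu>) < \<infinity>"
      by (simp add: emeasure_space_1[unfolded space_\<mu>])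
  qed (use le_B lim in auto)
  then show ?thesis
    by (simp add: attraction_eq)
qed

text \<open>
  The competitor is a multiple of a linear coordinate, pointing in a fixed direction of the target
  space, which is possible in every dimension. The multiple is chosen to make the
  repulsion less than \<open>c - 1\<close>, and for small \<open>h\<close> the attraction contributes less than one.
\<close>
lemma exists_low_energy:
  assumes "bounded \<Omega>" and \<kappa>: "0 < \<kappa>" and h: "\<And>n. 0 < h n" "h \<longlonglongrightarrow> 0"
  shows "\<exists>S :: real^'d \<Rightarrow> real^'m. S \<in> borel_measurable (lebesgue_on \<Omega>) \<and>
           (\<forall>\<^sub>F n in sequentially. energy \<Omega> \<rho> \<kappa> (h n) S < ereal c)"
proof -
  obtain b :: "real^'d" where b: "b \<in> Basis" "norm b = 1"
    using SOME_Basis norm_Basis by blast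
  obtain u :: "real^'m" where u: "norm u = 1"
    using SOME_Basis norm_Basis by blast
  define L where "L x = (x \<bullet> b) *\<^sub>R u" for x
  have cont: "continuous_on \<Omega> (\<lambda>x. real k *\<^sub>R L x)" for k
    unfolding L_def by (intro continuous_intros)
  have meas: "(\<lambda>x. real k *\<^sub>R L x) \<in> borel_measurable (lebesgue_on \<Omega>)" for k
    using cont by (intro continuous_imp_measurable_on_sets_lebesgue) auto
  have [measurable]: "L \<in> borel_measurable (lebesgue_on \<Omega>)"
    using meas[of 1] by simp
  have "AE x in \<mu>. AE y in \<mu>. L x \<noteq> L y"
  proof (rule AE_I2)
    fix x
    \<comment> \<open>The fibre of \<open>L\<close> through \<open>x\<close> is a hyperplane.\<close>
    have "negligible {y. b \<bullet> y = x \<bullet> b}"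
      using b by (intro negligible_hyperplane) auto
    then show "AE y in \<mu>. L x \<noteq> L y"
      by (rule AE_\<mu>_not_in_negligible[THEN eventually_mono]) (use u in \<open>auto simp: L_def inner_commute\<close>)
  qed
  then have "(\<lambda>k. mean_proximity \<mu> (\<lambda>x. real k *\<^sub>R L x)) \<longlonglongrightarrow> 0"
    by (intro mean_proximity_scaled_tendsto_0) measurable
  then have "\<forall>\<^sub>F k in sequentially. mean_proximity \<mu> (\<lambda>x. real k *\<^sub>R L x) < exp (c - 1)"
    by (rule order_tendstoD(2)) simp
  then obtain k where k: "mean_proximity \<mu> (\<lambda>x. real k *\<^sub>R L x) < exp (c - 1)"
    by (auto simp: eventually_sequentially)
  define S where "S x = real k *\<^sub>R L x" for x
  have S [measurable]: "S \<in> borel_measurable (lebesgue_on \<Omega>)"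
    unfolding S_def by (rule meas)
  have "0 < mean_proximity \<mu> S"
    by (rule mean_proximity_pos) measurable
  then have R: "repulsion \<Omega> \<rho> S < c - 1"
    using k unfolding repulsion_eq[OF S] S_def by (metis exp_less_cancel_iff exp_ln)
  obtain r where r: "\<And>x. x \<in> \<Omega> \<Longrightarrow> norm x \<le> r"
    using \<open>bounded \<Omega>\<close> by (auto simp: bounded_iff)
  have "(\<lambda>n. attraction \<Omega> \<rho> \<kappa> (h n) S) \<longlonglongrightarrow> 0"
  proof (rule attraction_tendsto_0[OF _ _ \<kappa> h])
    show "continuous_on \<Omega> S"
      unfolding S_def by (rule cont)
    show "norm (S x) \<le> real k * r" if "x \<in> \<Omega>" for x
    proof -
      have "\<bar>x \<bullet> b\<bar> \<le> r"
        using r[OF that] Cauchy_Schwarz_ineq2[of x b] b(2) by simp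
      then show ?thesis
        using u by (simp add: S_def L_def abs_mult mult_left_mono)
    qed
  qed
  then have "\<forall>\<^sub>F n in sequentially. attraction \<Omega> \<rho> \<kappa> (h n) S < 1"
    by (rule order_tendstoD(2)) simp
  then have "\<forall>\<^sub>F n in sequentially. energy \<Omega> \<rho> \<kappa> (h n) S < ereal c"
  proof eventually_elim
    case (elim n)
    then have "enn2ereal (attraction \<Omega> \<rho> \<kappa> (h n) S) < 1"
      using less_ennreal.rep_eq one_ennreal.rep_eq by metis
    then have "energy \<Omega> \<rho> \<kappa> (h n) S \<le> 1 + ereal (repulsion \<Omega> \<rho> S)"
      unfolding energy_def by (intro add_right_mono) simp
    also have "\<dots> < ereal c"
      using R by (simp add: one_ereal_def)
    finally show ?case .
  qed
  then show ?thesis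
    using S by blast
qed

text \<open>
  Positivity of the mean proximity of the limit is what keeps the logarithm continuous there.
\<close>
lemma repulsion_tendsto:
  fixes T :: "nat \<Rightarrow> real^'d \<Rightarrow> real^'m"
  assumes T: "\<And>n. T n \<in> borel_measurable (lebesgue_on \<Omega>)"
    and S: "S \<in> borel_measurable (lebesgue_on \<Omega>)"
    and lim: "AE x in lebesgue_on \<Omega>. (\<lambda>n. T n x) \<longlonglongrightarrow> S x"
  shows "(\<lambda>n. repulsion \<Omega> \<rho> (T n)) \<longlonglongrightarrow> repulsion \<Omega> \<rho> S"
proof -
  have "(\<lambda>n. mean_proximity \<mu> (T n)) \<longlonglongrightarrow> mean_proximity \<mu> S"
    using T S lim by (intro mean_proximity_tendsto) (simp_all add: borel_measurable_\<mu> AE_\<mu>_iff)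
  moreover have "0 < mean_proximity \<mu> S"
    using S by (intro mean_proximity_pos) (simp add: borel_measurable_\<mu>)
  ultimately show ?thesis
    unfolding repulsion_eq[OF T] repulsion_eq[OF S] by (intro tendsto_ln) auto
qed

end

section \<open>Minimizers do not converge\<close>

theorem theorem2p3:
  fixes \<Omega> :: "(real^'d) set"
    and \<rho> :: "real^'d \<Rightarrow> real"
    and \<rho>star \<kappa> :: real
    and h :: "nat \<Rightarrow> real"
    and T :: "nat \<Rightarrow> real^'d \<Rightarrow> real^'m"
  assumes "bounded \<Omega>" and "C2_domain \<Omega>"
    and "prob_density_on \<Omega> \<rho>"
    and "\<And>x. x \<in> \<Omega> \<Longrightarrow> 1 / \<rho>star < \<rho> x \<and> \<rho> x < \<rho>star"
    and "\<kappa> > 0"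
    and "\<And>n. h n > 0" and "h \<longlonglongrightarrow> 0"
    and "\<And>n. energy_minimizer \<Omega> \<rho> \<kappa> (h n) (T n)"
  shows "\<not> (\<exists>Tstar \<in> L_infinity \<Omega>. AE x in lebesgue_on \<Omega>. (\<lambda>n. T n x) \<longlonglongrightarrow> Tstar x)"
proof (rule notI, elim bexE)
  fix Tstar :: "real^'d \<Rightarrow> real^'m"
  assume "Tstar \<in> L_infinity \<Omega>" and lim: "AE x in lebesgue_on \<Omega>. (\<lambda>n. T n x) \<longlonglongrightarrow> Tstar x"
  then have Tstar: "Tstar \<in> borel_measurable (lebesgue_on \<Omega>)"
    by (simp add: L_infinity_def)
  have T: "T n \<in> borel_measurable (lebesgue_on \<Omega>)" for n
    using assms(8) by (simp add: energy_minimizer_def)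
  interpret positive_density \<Omega> \<rho>
  proof
    show "open \<Omega>"
      using assms(2) by (simp add: C2_domain_def)
    show "0 < \<rho> x" if x: "x \<in> \<Omega>" for x
    proof -
      have "0 \<le> \<rho> x"
        using assms(3) x by (simp add: prob_density_on_def)
      then have "0 < \<rho>star"
        using assms(4)[OF x] by linarith
      then have "0 < 1 / \<rho>star"
        by simp
      then show ?thesis
        using assms(4)[OF x] by linarith
    qed
  qed (rule assms(3))
  define c where "c = repulsion \<Omega> \<rho> Tstar - 1"
  obtain S :: "real^'d \<Rightarrow> real^'m" where S: "S \<in> borel_measurable (lebesgue_on \<Omega>)"
    and low: "\<forall>\<^sub>F n in sequentially. energy \<Omega> \<rho> \<kappa> (h n) S < ereal c"
    using exists_low_energy[OF assms(1,5,6,7)] by blast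
  have "\<forall>\<^sub>F n in sequentially. c < repulsion \<Omega> \<rho> (T n)"
    by (rule order_tendstoD(1)[OF repulsion_tendsto[OF T Tstar lim]]) (simp add: c_def)
  with low have "\<forall>\<^sub>F n in sequentially. False"
  proof eventually_elim
    case (elim n)
    have "ereal c < 0 + ereal (repulsion \<Omega> \<rho> (T n))"
      using elim by simp
    also have "\<dots> \<le> energy \<Omega> \<rho> \<kappa> (h n) (T n)"
      unfolding energy_def by (intro add_right_mono) simp
    also have "\<dots> \<le> energy \<Omega> \<rho> \<kappa> (h n) S"
      using assms(8) S by (simp add: energy_minimizer_def)
    finally show False
      using elim by simp
  qed
  then show False by simp
qed

end
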